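(* Let $\mathcal{A}$ be a finite poset, let $F,G$ be two presheaves over $\mathcal{A}$ with values in finite sets, and let $\phi:F\to G$ be a natural transformation. Let $H=(H_a:F_a\to\mathbb{R};\ a\in\mathcal{A})$ be any collection of functions (Hamiltonians), and choose, for every $a\in\mathcal{A}$, an arbitrary scalar product on $\widetilde F_a=\mathbb{R}^{F_a}$ and an arbitrary scalar product on $\widetilde G_a=\mathbb{R}^{G_a}$. For $a\in\mathcal{A}$ and $y\in G_a$ put $$\widetilde H_a(y)=-\ln\sum_{x\in F_a:\ \phi_a(x)=y}e^{-H_a(x)},$$ with the convention $\widetilde H_a(y)=+\infty$ if $y\notin\operatorname{im}\phi_a$. Then $$\Delta MP_{G,\widetilde H}=\phi_1\circ\Delta MP_{F,H}\circ\phi_1^{\dagger}$$ as maps $G_{\rightarrow}\to G_{\rightarrow}$.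
   Context: A presheaf $F$ over a finite poset $(\mathcal{A},\le)$ with values in finite sets assigns to each $a\in\mathcal{A}$ a finite set $F_a$ and to each pair $b\le a$ a map $F^a_b:F_a\to F_b$, with $F^a_a=\mathrm{id}$ and $F^b_c\circ F^a_b=F^a_c$ for $c\le b\le a$. A natural transformation $\phi:F\to G$ is a family of maps $\phi_a:F_a\to G_a$ with $G^a_b\circ\phi_a=\phi_b\circ F^a_b$ for all $b\le a$. Linearization: $\widetilde F_a=\mathbb{R}^{F_a}$, and for $b\le a$ the linear map $\widetilde F^a_b:\widetilde F_a\to\widetilde F_b$ is the pushforward $\widetilde F^a_b(\lambda)(x)=\sum_{y\in F_a:\,F^a_b(y)=x}\lambda(y)$. Likewise $\widetilde\phi_a:\widetilde F_a\to\widetilde G_a$, $\widetilde\phi_a(h)(y)=\sum_{x\in F_a:\,\phi_a(x)=y}h(x)$. Given a scalar product $\langle\cdot,\cdot\rangle_a$ on each $\widetilde F_a$, let $\widetilde F^{a,\dagger}_b:\widetilde F_b\to\widetilde F_a$ be the adjoint of $\widetilde F^a_b$. The space of messages is $F_{\rightarrow}=\bigoplus_{a,b\in\mathcal{A}:\,b\le a}\widetilde F_b$, with elements written $l=(l_{a\to b})_{b\le a}$, $l_{a\to b}\in\widetilde F_b$, and scalar product $\langle l,l'\rangle=\sum_{b\le a}\langle l_{a\to b},l'_{a\to b}\rangle_b$. Operators: - $\delta_F:\bigoplus_a\widetilde F_a\to F_{\rightarrow}$, $\delta_F(v)_{a\to b}=\widetilde F^a_b(v_a)-v_b$. - $d_{F^\dagger}:F_{\rightarrow}\to\bigoplus_a\widetilde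 F_a$, $d_{F^\dagger}(l)_a=\sum_{b\le a}\widetilde F^{a,\dagger}_b(l_{a\to b})-\sum_{b\ge a}l_{b\to a}$. - $\zeta_{F^\dagger}:\bigoplus_a\widetilde F_a\to\bigoplus_a\widetilde F_a$, $\zeta_{F^\dagger}(v)_a=\sum_{b\le a}\widetilde F^{a,\dagger}_b(v_b)$. - For Hamiltonians $H=(H_a:F_a\to\mathbb{R}\cup\{+\infty\})_{a\in\mathcal{A}}$, $g_H^{\langle\cdot,\cdot\rangle}:\bigoplus_a\widetilde F_a\to\bigoplus_a\widetilde F_a$ is given by $g_H^{\langle\cdot,\cdot\rangle}(v)_a(x)=\exp\big(-H_a(x)+\langle v_a,1_x\rangle_a-1\big)$ for $x\in F_a$, where $1_x\in\mathbb{R}^{F_a}$ is the indicator function of $x$ and $e^{-\infty}=0$. (For finite $H_a$ this is the inverse of the differential of $h_a\mapsto\sum_{x}h_a(x)H_a(x)+\sum_x h_a(x)\ln h_a(x)$, after identifying $\widetilde F_a^*$ with $\widetilde F_a$ through $\langle\cdot,\cdot\rangle_a$.) The message-passing increment is $\Delta MP_{F,H}=\delta_F\circ g_H^{\langle\cdot,\cdot\rangle}\circ\zeta_{F^\dagger}\circ d_{F^\dagger}:F_{\rightarrow}\to F_{\rightarrow}$, and similarly for $G$ with its own scalar products. The map $\phi_1:F_{\rightarrow}\to G_{\rightarrow}$ is $\phi_1(v)_{a\to b}=\widetilde\phi_b(v_{a\to b})$, and $\phi_1^\dagger:G_{\rightarrow}\to F_{\rightarrow}$ is its adjoint for the chosen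 scalar products, i.e. $\phi_1^\dagger=\bigoplus_{b\le a}\widetilde\phi_b^{\,\dagger}$. *)

theory Defs
  imports "HOL-Library.FuncSet" "HOL-Library.Indicator_Function" "HOL-Library.Extended_Real"
begin

(* A finite poset is a finite subset A of an ordered type.  Data of presheaves outside A, outside
   the pairs b \<le> a, or outside the carriers is irrelevant. *)

record ('p, 'x) presheaf =
  obj :: "'p \<Rightarrow> 'x set"
  res :: "'p \<Rightarrow> 'p \<Rightarrow> 'x \<Rightarrow> 'x"  (* res F a b : obj F a \<rightarrow> obj F b  for  b \<le> a *)

definition presheaf_on :: "'p::order set \<Rightarrow> ('p, 'x) presheaf \<Rightarrow> bool" where
  "presheaf_on A F \<longleftrightarrow>
     (\<forall>a\<in>A. finite (obj F a)) \<and>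
     (\<forall>a\<in>A. \<forall>b\<in>A. b \<le> a \<longrightarrow> res F a b \<in> obj F a \<rightarrow> obj F b) \<and>
     (\<forall>a\<in>A. \<forall>x\<in>obj F a. res F a a x = x) \<and>
     (\<forall>a\<in>A. \<forall>b\<in>A. \<forall>c\<in>A. c \<le> b \<longrightarrow> b \<le> a \<longrightarrow>
        (\<forall>x\<in>obj F a. res F b c (res F a b x) = res F a c x))"

definition nat_trans ::
  "'p::order set \<Rightarrow> ('p, 'x) presheaf \<Rightarrow> ('p, 'y) presheaf \<Rightarrow> ('p \<Rightarrow> 'x \<Rightarrow> 'y) \<Rightarrow> bool" where
  "nat_trans A F G \<phi> \<longleftrightarrow>
     (\<forall>a\<in>A. \<phi> a \<in> obj F a \<rightarrow> obj G a) \<and>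
     (\<forall>a\<in>A. \<forall>b\<in>A. b \<le> a \<longrightarrow>
        (\<forall>x\<in>obj F a. res G a b (\<phi> a x) = \<phi> b (res F a b x)))"

(* The vector space of real functions on S, realised as functions on the whole type that vanish
   outside S. *)

definition lin :: "'x set \<Rightarrow> ('x \<Rightarrow> real) set" where
  "lin S = {h. \<forall>x. x \<notin> S \<longrightarrow> h x = 0}"

definition pushforward :: "'x set \<Rightarrow> ('x \<Rightarrow> 'y) \<Rightarrow> ('x \<Rightarrow> real) \<Rightarrow> ('y \<Rightarrow> real)" where
  "pushforward S f h = (\<lambda>y. \<Sum>x\<in>{x \<in> S. f x = y}. h x)"

abbreviation lin_res :: "('p, 'x) presheaf \<Rightarrow> 'p \<Rightarrow> 'p \<Rightarrow> ('x \<Rightarrow> real) \<Rightarrow> ('x \<Rightarrow> real)" where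
  "lin_res F a b \<equiv> pushforward (obj F a) (res F a b)"

definition scalar_product_on ::
  "('x \<Rightarrow> real) set \<Rightarrow> (('x \<Rightarrow> real) \<Rightarrow> ('x \<Rightarrow> real) \<Rightarrow> real) \<Rightarrow> bool" where
  "scalar_product_on V ip \<longleftrightarrow>
     (\<forall>u\<in>V. \<forall>v\<in>V. ip u v = ip v u) \<and>
     (\<forall>u\<in>V. \<forall>v\<in>V. \<forall>w\<in>V. ip (\<lambda>x. u x + v x) w = ip u w + ip v w) \<and>
     (\<forall>c. \<forall>u\<in>V. \<forall>w\<in>V. ip (\<lambda>x. c * u x) w = c * ip u w) \<and>
     (\<forall>u\<in>V. u \<noteq> (\<lambda>x. 0) \<longrightarrow> ip u u > 0)"

(* Adjoint of f from the space V with scalar product ipV to a space with scalar product ipW;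
   existence and uniqueness hold for linear f between finite-dimensional spaces.
   The library constant adjoint only covers the scalar product fixed by the class real_inner. *)

definition adjoint_on ::
  "'v set \<Rightarrow> ('v \<Rightarrow> 'v \<Rightarrow> real) \<Rightarrow> ('w \<Rightarrow> 'w \<Rightarrow> real) \<Rightarrow> ('v \<Rightarrow> 'w) \<Rightarrow> 'w \<Rightarrow> 'v" where
  "adjoint_on V ipV ipW f w = (THE v. v \<in> V \<and> (\<forall>u\<in>V. ipV u v = ipW (f u) w))"

type_synonym ('p, 'x) scalar_products = "'p \<Rightarrow> ('x \<Rightarrow> real) \<Rightarrow> ('x \<Rightarrow> real) \<Rightarrow> real"

abbreviation res_adj ::
  "('p, 'x) presheaf \<Rightarrow> ('p, 'x) scalar_products \<Rightarrow> 'p \<Rightarrow> 'p \<Rightarrow> ('x \<Rightarrow> real) \<Rightarrow> ('x \<Rightarrow> real)" where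
  "res_adj F ip a b \<equiv> adjoint_on (lin (obj F a)) (ip a) (ip b) (lin_res F a b)"

(* Elements of a direct sum are families that vanish outside the index set.  The message from a
   to b is  l (a, b). *)

type_synonym ('p, 'x) family = "'p \<Rightarrow> 'x \<Rightarrow> real"
type_synonym ('p, 'x) message = "'p \<times> 'p \<Rightarrow> 'x \<Rightarrow> real"

definition arrows :: "'p::order set \<Rightarrow> ('p \<times> 'p) set" where
  "arrows A = {(a, b). a \<in> A \<and> b \<in> A \<and> b \<le> a}"

definition messages :: "'p::order set \<Rightarrow> ('p, 'x) presheaf \<Rightarrow> ('p, 'x) message set" where
  "messages A F = {l. (\<forall>(a, b)\<in>arrows A. l (a, b) \<in> lin (obj F b)) \<and>
                      (\<forall>e. e \<notin> arrows A \<longrightarrow> l e = (\<lambda>x. 0))}"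

definition message_ip ::
  "'p::order set \<Rightarrow> ('p, 'x) scalar_products \<Rightarrow> ('p, 'x) message \<Rightarrow> ('p, 'x) message \<Rightarrow> real" where
  "message_ip A ip l l' = (\<Sum>(a, b)\<in>arrows A. ip b (l (a, b)) (l' (a, b)))"

definition delta :: "'p::order set \<Rightarrow> ('p, 'x) presheaf \<Rightarrow> ('p, 'x) family \<Rightarrow> ('p, 'x) message" where
  "delta A F v = (\<lambda>(a, b). if (a, b) \<in> arrows A
     then (\<lambda>x. lin_res F a b (v a) x - v b x) else (\<lambda>x. 0))"

definition d_adj ::
  "'p::order set \<Rightarrow> ('p, 'x) presheaf \<Rightarrow> ('p, 'x) scalar_products \<Rightarrow>
     ('p, 'x) message \<Rightarrow> ('p, 'x) family" where
  "d_adj A F ip l = (\<lambda>a. if a \<in> A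
     then (\<lambda>x. (\<Sum>b\<in>{b \<in> A. b \<le> a}. res_adj F ip a b (l (a, b)) x) - (\<Sum>b\<in>{b \<in> A. a \<le> b}. l (b, a) x))
     else (\<lambda>x. 0))"

definition zeta_adj ::
  "'p::order set \<Rightarrow> ('p, 'x) presheaf \<Rightarrow> ('p, 'x) scalar_products \<Rightarrow>
     ('p, 'x) family \<Rightarrow> ('p, 'x) family" where
  "zeta_adj A F ip v = (\<lambda>a. if a \<in> A
     then (\<lambda>x. \<Sum>b\<in>{b \<in> A. b \<le> a}. res_adj F ip a b (v b) x)
     else (\<lambda>x. 0))"

(* Exponential with exp (-\<infinity>) = 0; it is never applied to +\<infinity>. *)

definition exp_ereal :: "ereal \<Rightarrow> real" where
  "exp_ereal z = (if z = -\<infinity> then 0 else exp (real_of_ereal z))"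

(* H takes values in the reals and +\<infinity>.  On real-valued H this inverts the differential of
   h \<mapsto> \<Sum>x. h x * H x + \<Sum>x. h x * ln (h x). *)

definition g_ham ::
  "'p::order set \<Rightarrow> ('p, 'x) presheaf \<Rightarrow> ('p, 'x) scalar_products \<Rightarrow> ('p \<Rightarrow> 'x \<Rightarrow> ereal) \<Rightarrow>
     ('p, 'x) family \<Rightarrow> ('p, 'x) family" where
  "g_ham A F ip H v = (\<lambda>a x. if a \<in> A \<and> x \<in> obj F a
     then exp_ereal (- H a x + ereal (ip a (v a) (indicator {x})) - 1)
     else 0)"

definition delta_MP ::
  "'p::order set \<Rightarrow> ('p, 'x) presheaf \<Rightarrow> ('p, 'x) scalar_products \<Rightarrow> ('p \<Rightarrow> 'x \<Rightarrow> ereal) \<Rightarrow>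
     ('p, 'x) message \<Rightarrow> ('p, 'x) message" where
  "delta_MP A F ip H = delta A F \<circ> g_ham A F ip H \<circ> zeta_adj A F ip \<circ> d_adj A F ip"

definition phi1 ::
  "'p::order set \<Rightarrow> ('p, 'x) presheaf \<Rightarrow> ('p \<Rightarrow> 'x \<Rightarrow> 'y) \<Rightarrow> ('p, 'x) message \<Rightarrow> ('p, 'y) message" where
  "phi1 A F \<phi> l = (\<lambda>(a, b). if (a, b) \<in> arrows A
     then pushforward (obj F b) (\<phi> b) (l (a, b)) else (\<lambda>y. 0))"

definition phi1_adj ::
  "'p::order set \<Rightarrow> ('p, 'x) presheaf \<Rightarrow> ('p, 'x) scalar_products \<Rightarrow> ('p, 'y) scalar_products \<Rightarrow>
     ('p \<Rightarrow> 'x \<Rightarrow> 'y) \<Rightarrow> ('p, 'y) message \<Rightarrow> ('p, 'x) message" where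
  "phi1_adj A F ipF ipG \<phi> =
     adjoint_on (messages A F) (message_ip A ipF) (message_ip A ipG) (phi1 A F \<phi>)"

definition pushforward_ham ::
  "('p, 'x) presheaf \<Rightarrow> ('p \<Rightarrow> 'x \<Rightarrow> 'y) \<Rightarrow> ('p \<Rightarrow> 'x \<Rightarrow> real) \<Rightarrow> 'p \<Rightarrow> 'y \<Rightarrow> ereal" where
  "pushforward_ham F \<phi> H a y = (if y \<in> \<phi> a ` obj F a
     then ereal (- ln (\<Sum>x\<in>{x \<in> obj F a. \<phi> a x = y}. exp (- H a x)))
     else \<infinity>)"

end

theory Submission
  imports Defs
begin

text \<open>
  Naturality of \<open>\<phi>\<close> says that \<open>\<phi>\<close> intertwines the linearised restriction maps of \<open>F\<close> and \<open>G\<close>, so it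
  intertwines \<open>delta\<close>; dually \<open>\<phi>\<^sup>\<dagger>\<close> intertwines the adjoint restriction maps, hence \<open>d_adj\<close> and
  \<open>zeta_adj\<close>. What remains is \<open>g\<close> conjugated by \<open>\<phi>\<close>: since
  \<open>\<langle>\<phi>\<^sup>\<dagger> v, 1\<^sub>x\<rangle> = \<langle>v, \<phi> 1\<^sub>x\<rangle>\<close> and \<open>\<phi> 1\<^sub>x\<close> is the indicator of \<open>\<phi> x\<close>, this number is constant on the
  fibres of \<open>\<phi>\<close>, and summing the exponentials over a fibre replaces \<open>H\<close> by its pushforward.
\<close>

section \<open>Linearised sets and pushforwards\<close>

lemma lin_zero [simp]: "(\<lambda>x. 0) \<in> lin S"
  and lin_add: "u \<in> lin S \<Longrightarrow> v \<in> lin S \<Longrightarrow> (\<lambda>x. u x + v x) \<in> lin S"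
  and lin_diff: "u \<in> lin S \<Longrightarrow> v \<in> lin S \<Longrightarrow> (\<lambda>x. u x - v x) \<in> lin S"
  and lin_scale: "u \<in> lin S \<Longrightarrow> (\<lambda>x. c * u x) \<in> lin S"
  and lin_indicator: "x \<in> S \<Longrightarrow> indicator {x} \<in> lin S"
  by (auto simp: lin_def indicator_def)

lemma lin_sum: "(\<And>i. i \<in> I \<Longrightarrow> v i \<in> lin S) \<Longrightarrow> (\<lambda>x. \<Sum>i\<in>I. v i x) \<in> lin S"
  by (auto simp: lin_def intro: sum.neutral)

lemma lin_mono: "S \<subseteq> T \<Longrightarrow> lin S \<subseteq> lin T"
  by (auto simp: lin_def)

lemma pushforward_in_lin: "f \<in> S \<rightarrow> T \<Longrightarrow> pushforward S f h \<in> lin T"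
  by (auto simp: lin_def pushforward_def intro!: sum.neutral)

lemma pushforward_add:
  "pushforward S f (\<lambda>x. u x + v x) = (\<lambda>y. pushforward S f u y + pushforward S f v y)"
  by (simp add: pushforward_def sum.distrib)

lemma pushforward_diff:
  "pushforward S f (\<lambda>x. u x - v x) = (\<lambda>y. pushforward S f u y - pushforward S f v y)"
  by (simp add: pushforward_def sum_subtractf)

lemma pushforward_scale:
  "pushforward S f (\<lambda>x. c * u x) = (\<lambda>y. c * pushforward S f u y)"
  by (simp add: pushforward_def sum_distrib_left)

lemma pushforward_cong:
  "(\<And>x. x \<in> S \<Longrightarrow> f x = g x) \<Longrightarrow> pushforward S f = pushforward S g"
  unfolding pushforward_def by (intro ext sum.cong) auto

lemma pushforward_indicator:
  assumes "finite S" "x \<in> S"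
  shows "pushforward S f (indicator {x}) = indicator {f x}"
proof
  fix y
  have "pushforward S f (indicator {x}) y = (\<Sum>z\<in>{z \<in> S. f z = y}. if z = x then 1 else 0)"
    unfolding pushforward_def by (rule sum.cong) auto
  also have "\<dots> = indicator {f x} y"
    using assms by (subst sum.delta) (auto simp: indicator_def)
  finally show "pushforward S f (indicator {x}) y = indicator {f x} y" .
qed

text \<open>Functoriality of linearisation: the fibre of the composite over \<open>y\<close> is the
  disjoint union of the fibres of \<open>f\<close> over the points of \<open>T\<close> that
  \<open>g\<close> sends to \<open>y\<close>.\<close>

lemma pushforward_pushforward:
  assumes "finite S" "finite T" "f \<in> S \<rightarrow> T"
  shows "pushforward T g (pushforward S f h) = pushforward S (\<lambda>x. g (f x)) h"
proof
  fix y
  have "pushforward T g (pushforward S f h) y =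
      (\<Sum>z\<in>{z \<in> T. g z = y}. \<Sum>x\<in>{x \<in> {x \<in> S. g (f x) = y}. f x = z}. h x)"
    unfolding pushforward_def by (intro sum.cong) auto
  also have "\<dots> = (\<Sum>x\<in>{x \<in> S. g (f x) = y}. h x)"
    using assms by (intro sum.group) auto
  finally show "pushforward T g (pushforward S f h) y = pushforward S (\<lambda>x. g (f x)) h y"
    by (simp add: pushforward_def)
qed

section \<open>Scalar products on real functions over a finite set\<close>

locale euclidean_lin =
  fixes S :: "'x set" and ip :: "('x \<Rightarrow> real) \<Rightarrow> ('x \<Rightarrow> real) \<Rightarrow> real"
  assumes fin: "finite S" and sp: "scalar_product_on (lin S) ip"
begin

lemma ip_sym: "u \<in> lin S \<Longrightarrow> v \<in> lin S \<Longrightarrow> ip u v = ip v u"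
  using sp unfolding scalar_product_on_def by blast

lemma ip_add: "u \<in> lin S \<Longrightarrow> v \<in> lin S \<Longrightarrow> w \<in> lin S \<Longrightarrow> ip (\<lambda>x. u x + v x) w = ip u w + ip v w"
  using sp unfolding scalar_product_on_def by blast

lemma ip_scale: "u \<in> lin S \<Longrightarrow> w \<in> lin S \<Longrightarrow> ip (\<lambda>x. c * u x) w = c * ip u w"
  using sp unfolding scalar_product_on_def by blast

lemma ip_pos: "u \<in> lin S \<Longrightarrow> u \<noteq> (\<lambda>x. 0) \<Longrightarrow> ip u u > 0"
  using sp unfolding scalar_product_on_def by blast

lemma ip_add_right:
  "u \<in> lin S \<Longrightarrow> v \<in> lin S \<Longrightarrow> w \<in> lin S \<Longrightarrow> ip u (\<lambda>x. v x + w x) = ip u v + ip u w"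
  using ip_add[of v w u] by (simp add: ip_sym lin_add)

lemma ip_scale_right: "u \<in> lin S \<Longrightarrow> v \<in> lin S \<Longrightarrow> ip u (\<lambda>x. c * v x) = c * ip u v"
  using ip_scale[of v u c] by (simp add: ip_sym lin_scale)

lemma ip_diff_right:
  "u \<in> lin S \<Longrightarrow> v \<in> lin S \<Longrightarrow> w \<in> lin S \<Longrightarrow> ip u (\<lambda>x. v x - w x) = ip u v - ip u w"
  using ip_add_right[of u v "\<lambda>x. (-1) * w x"] ip_scale_right[of u w "-1"] lin_scale[of w S "-1"]
  by simp

lemma ip_zero: "u \<in> lin S \<Longrightarrow> ip (\<lambda>x. 0) u = 0"
  using ip_scale[of "\<lambda>x. 0" u 0] by simp

lemma ip_zero_right: "u \<in> lin S \<Longrightarrow> ip u (\<lambda>x. 0) = 0"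
  using ip_scale_right[of u "\<lambda>x. 0" 0] by simp

lemma ip_sum_right:
  assumes "u \<in> lin S" "\<And>i. i \<in> I \<Longrightarrow> v i \<in> lin S"
  shows "ip u (\<lambda>x. \<Sum>i\<in>I. v i x) = (\<Sum>i\<in>I. ip u (v i))"
  using assms(2)
\<comment> \<open>For infinite \<open>I\<close> both sums take the default value 0, so that case
  reduces to \<open>ip_zero_right\<close>.\<close>
proof (induction I rule: infinite_finite_induct)
  case (insert i I)
  then show ?case
    using assms(1) by (simp add: ip_add_right lin_sum)
qed (simp_all add: ip_zero_right assms(1))

text \<open>Testing against \<open>v - w\<close> itself and using positive definiteness.\<close>

lemma ip_eqI:
  assumes "v \<in> lin S" "w \<in> lin S" "\<And>u. u \<in> lin S \<Longrightarrow> ip u v = ip u w"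
  shows "v = w"
proof -
  let ?d = "\<lambda>x. v x - w x"
  have "?d \<in> lin S"
    using assms by (simp add: lin_diff)
  moreover from this have "ip ?d ?d = 0"
    using assms by (simp add: ip_diff_right)
  ultimately have "?d = (\<lambda>x. 0)"
    using ip_pos by force
  then show ?thesis
    by (simp add: fun_eq_iff)
qed

text \<open>Replaces the definite description by a check of the adjoint identity, uniqueness being
  \<open>ip_eqI\<close>. Later identities between adjoints on \<open>lin S\<close> are proved this
  way.\<close>

lemma adjoint_on_eqI:
  assumes "v \<in> lin S" "\<And>u. u \<in> lin S \<Longrightarrow> ip u v = ipW (f u) w"
  shows "adjoint_on (lin S) ip ipW f w = v"
  unfolding adjoint_on_def
  using assms by (intro the_equality) (auto intro: ip_eqI)

end

text \<open>
  Riesz representation. In the induction step \<open>e - p\<close>, with \<open>p\<close> the orthogonal projection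
  of the new basis vector \<open>e\<close> to \<open>lin S\<close>, spans the orthogonal complement of \<open>lin S\<close>.
\<close>

lemma riesz_lin:
  assumes "finite S" "scalar_product_on (lin S) ip"
    and "\<And>u v. u \<in> lin S \<Longrightarrow> v \<in> lin S \<Longrightarrow> f (\<lambda>x. u x + v x) = f u + f v"
    and "\<And>c u. u \<in> lin S \<Longrightarrow> f (\<lambda>x. c * u x) = c * (f u :: real)"
  shows "\<exists>v\<in>lin S. \<forall>u\<in>lin S. ip u v = f u"
  using assms
proof (induction S arbitrary: f rule: finite_induct)
  case empty
  have "lin {} = {\<lambda>x::'a. 0}"
    by (auto simp: lin_def)
  moreover have "ip (\<lambda>x. 0) (\<lambda>x. 0) = 0"
    using euclidean_lin.ip_zero[of "{}" ip] empty by (simp add: euclidean_lin_def)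
  moreover have "f (\<lambda>x. 0) = 0"
    using empty(3)[of "\<lambda>x. 0" 0] by simp
  ultimately show ?case by simp
next
  case (insert a S)
  interpret euclidean_lin "insert a S" ip
    using insert by unfold_locales auto
  have sub: "u \<in> lin S \<Longrightarrow> u \<in> lin (insert a S)" for u
    using lin_mono[of S "insert a S"] by blast
  have sp': "scalar_product_on (lin S) ip"
    using sub by (auto simp: scalar_product_on_def ip_add ip_scale ip_pos intro: ip_sym)
  define e :: "'a \<Rightarrow> real" where "e = indicator {a}"
  have e: "e \<in> lin (insert a S)"
    by (simp add: e_def lin_indicator)
  \<comment> \<open>The functional is arbitrary in the induction, so the hypothesis serves twice:
    for pairing with \<open>e\<close>, which yields \<open>p\<close>, and for \<open>f\<close>
    itself, which yields \<open>v\<close>.\<close>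
  have "\<exists>p\<in>lin S. \<forall>u\<in>lin S. ip u p = ip u e"
    using insert.IH[OF sp', of "\<lambda>u. ip u e"] by (simp add: ip_add ip_scale sub e)
  then obtain p where p: "p \<in> lin S" "\<And>u. u \<in> lin S \<Longrightarrow> ip u p = ip u e"
    by blast
  have "\<exists>v\<in>lin S. \<forall>u\<in>lin S. ip u v = f u"
    using insert.IH[OF sp', of f] insert.prems by (simp add: sub)
  then obtain v where v: "v \<in> lin S" "\<And>u. u \<in> lin S \<Longrightarrow> ip u v = f u"
    by blast
  define w where "w = (\<lambda>x. e x - p x)"
  have w: "w \<in> lin (insert a S)"
    unfolding w_def by (intro lin_diff e sub p)
  have orth: "ip u w = 0" if "u \<in> lin S" for u
    using that p e by (simp add: w_def ip_diff_right sub)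
  \<comment> \<open>\<open>p\<close> vanishes at \<open>a\<close>, which lies outside
    \<open>S\<close>. The value 1 makes \<open>w\<close> nonzero and makes
    \<open>u - u a * w\<close> vanish at \<open>a\<close>, hence lie in
    \<open>lin S\<close>.\<close>
  have wa: "w a = 1"
    using p(1) insert.hyps by (simp add: w_def e_def lin_def)
  then have "ip w w > 0"
    using ip_pos[OF w] by force
  \<comment> \<open>Since \<open>v\<close> is orthogonal to \<open>w\<close>, this is the
    coefficient for which \<open>v + c * w\<close> represents \<open>f\<close> at \<open>w\<close>;
    adding a multiple of \<open>w\<close> leaves the values on \<open>lin S\<close>
    unchanged.\<close>
  define c where "c = f w / ip w w"
  show ?case
  proof (intro bexI ballI)
    show v': "(\<lambda>x. v x + c * w x) \<in> lin (insert a S)"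
      by (intro lin_add lin_scale sub v w)
    fix u assume u: "u \<in> lin (insert a S)"
    define u' where "u' = (\<lambda>x. u x - u a * w x)"
    have u': "u' \<in> lin S"
      using lin_diff[OF u lin_scale[OF w, of "u a"]] wa
      by (auto simp: u'_def lin_def) (metis mult.right_neutral)
    have *: "u = (\<lambda>x. u' x + u a * w x)"
      by (simp add: u'_def)
    have "ip u (\<lambda>x. v x + c * w x) = ip u v + c * ip u w"
      using u v w by (simp add: ip_add_right ip_scale_right lin_scale sub)
    also have "ip u v = f u'"
      by (subst *) (use u' v w orth in \<open>simp add: ip_add ip_scale lin_scale sub ip_sym[of w v]\<close>)
    also have "ip u w = u a * ip w w"
      by (subst *) (use u' w orth in \<open>simp add: ip_add ip_scale lin_scale sub\<close>)
    also have "f u' + c * (u a * ip w w) = f u' + u a * f w"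
      using \<open>ip w w > 0\<close> by (simp add: c_def)
    also have "\<dots> = f u"
      using insert.prems(2)[OF sub[OF u'] lin_scale[OF w, of "u a"]] insert.prems(3)[OF w, of "u a"] *
      by simp
    finally show "ip u (\<lambda>x. v x + c * w x) = f u" .
  qed
qed

section \<open>Adjoints of pushforwards\<close>

locale euclidean_lin_map =
  V: euclidean_lin S ipV + W: euclidean_lin T ipW
  for S :: "'x set" and ipV and T :: "'y set" and ipW +
  fixes f :: "'x \<Rightarrow> 'y"
  assumes maps: "f \<in> S \<rightarrow> T"
begin

abbreviation adj :: "('y \<Rightarrow> real) \<Rightarrow> 'x \<Rightarrow> real" where
  "adj \<equiv> adjoint_on (lin S) ipV ipW (pushforward S f)"

text \<open>Riesz representation of the functional that pushes forward and then pairs with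
  \<open>w\<close>.\<close>

lemma adj_ex: "w \<in> lin T \<Longrightarrow> \<exists>v\<in>lin S. \<forall>u\<in>lin S. ipV u v = ipW (pushforward S f u) w"
  by (rule riesz_lin[OF V.fin V.sp])
    (simp_all add: pushforward_add pushforward_scale W.ip_add W.ip_scale pushforward_in_lin[OF maps])

lemma adj_in_lin: "w \<in> lin T \<Longrightarrow> adj w \<in> lin S"
  and ip_adj: "w \<in> lin T \<Longrightarrow> u \<in> lin S \<Longrightarrow> ipV u (adj w) = ipW (pushforward S f u) w"
proof -
  assume "w \<in> lin T"
  then obtain v where v: "v \<in> lin S" "\<And>u. u \<in> lin S \<Longrightarrow> ipV u v = ipW (pushforward S f u) w"
    using adj_ex by blast
  have "adj w = v"
    by (intro V.adjoint_on_eqI v)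
  then show "adj w \<in> lin S" "u \<in> lin S \<Longrightarrow> ipV u (adj w) = ipW (pushforward S f u) w"
    using v by simp_all
qed

lemma adj_diff:
  assumes "v \<in> lin T" "w \<in> lin T"
  shows "adj (\<lambda>y. v y - w y) = (\<lambda>x. adj v x - adj w x)"
  using assms
  by (intro V.adjoint_on_eqI)
    (simp_all add: lin_diff adj_in_lin ip_adj V.ip_diff_right W.ip_diff_right
      pushforward_in_lin[OF maps])

lemma adj_sum:
  assumes "\<And>i. i \<in> I \<Longrightarrow> v i \<in> lin T"
  shows "adj (\<lambda>y. \<Sum>i\<in>I. v i y) = (\<lambda>x. \<Sum>i\<in>I. adj (v i) x)"
  using assms
  by (intro V.adjoint_on_eqI)
    (simp_all add: lin_sum adj_in_lin ip_adj V.ip_sum_right W.ip_sum_right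
      pushforward_in_lin[OF maps])

end

section \<open>Natural transformations and their adjoints\<close>

locale natural_map =
  fixes A :: "'p::order set"
    and F :: "('p, 'x) presheaf" and G :: "('p, 'y) presheaf"
    and \<phi> :: "'p \<Rightarrow> 'x \<Rightarrow> 'y"
    and ipF :: "('p, 'x) scalar_products" and ipG :: "('p, 'y) scalar_products"
  assumes finA: "finite A"
    and F: "presheaf_on A F" and G: "presheaf_on A G"
    and \<phi>: "nat_trans A F G \<phi>"
    and spF: "\<And>a. a \<in> A \<Longrightarrow> scalar_product_on (lin (obj F a)) (ipF a)"
    and spG: "\<And>a. a \<in> A \<Longrightarrow> scalar_product_on (lin (obj G a)) (ipG a)"
begin

lemma finF: "a \<in> A \<Longrightarrow> finite (obj F a)" and finG: "a \<in> A \<Longrightarrow> finite (obj G a)"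
  using F G by (auto simp: presheaf_on_def)

lemma resF: "a \<in> A \<Longrightarrow> b \<in> A \<Longrightarrow> b \<le> a \<Longrightarrow> res F a b \<in> obj F a \<rightarrow> obj F b"
  and resG: "a \<in> A \<Longrightarrow> b \<in> A \<Longrightarrow> b \<le> a \<Longrightarrow> res G a b \<in> obj G a \<rightarrow> obj G b"
  using F G unfolding presheaf_on_def by blast+

lemma \<phi>_maps: "a \<in> A \<Longrightarrow> \<phi> a \<in> obj F a \<rightarrow> obj G a"
  using \<phi> by (simp add: nat_trans_def)

lemma map_resF:
  "a \<in> A \<Longrightarrow> b \<in> A \<Longrightarrow> b \<le> a \<Longrightarrow>
    euclidean_lin_map (obj F a) (ipF a) (obj F b) (ipF b) (res F a b)"
  by unfold_locales (use finF spF resF in blast)+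

lemma map_resG:
  "a \<in> A \<Longrightarrow> b \<in> A \<Longrightarrow> b \<le> a \<Longrightarrow>
    euclidean_lin_map (obj G a) (ipG a) (obj G b) (ipG b) (res G a b)"
  by unfold_locales (use finG spG resG in blast)+

lemma map_\<phi>:
  "a \<in> A \<Longrightarrow> euclidean_lin_map (obj F a) (ipF a) (obj G a) (ipG a) (\<phi> a)"
  by unfold_locales (use finF finG spF spG \<phi>_maps in blast)+

abbreviation \<phi>_lin :: "'p \<Rightarrow> ('x \<Rightarrow> real) \<Rightarrow> 'y \<Rightarrow> real" where
  "\<phi>_lin a \<equiv> pushforward (obj F a) (\<phi> a)"

abbreviation \<phi>_adj :: "'p \<Rightarrow> ('y \<Rightarrow> real) \<Rightarrow> 'x \<Rightarrow> real" where
  "\<phi>_adj a \<equiv> adjoint_on (lin (obj F a)) (ipF a) (ipG a) (\<phi>_lin a)"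

text \<open>The naturality square, linearised: both composites are pushforwards along maps that
  agree on \<open>obj F a\<close>.\<close>

lemma \<phi>_lin_res:
  assumes "a \<in> A" "b \<in> A" "b \<le> a"
  shows "\<phi>_lin b (lin_res F a b v) = lin_res G a b (\<phi>_lin a v)"
proof -
  have nat: "pushforward (obj F a) (\<lambda>x. \<phi> b (res F a b x)) =
      pushforward (obj F a) (\<lambda>x. res G a b (\<phi> a x))"
    by (rule pushforward_cong) (use \<phi> assms in \<open>simp add: nat_trans_def\<close>)
  have "\<phi>_lin b (lin_res F a b v) = pushforward (obj F a) (\<lambda>x. \<phi> b (res F a b x)) v"
    by (intro pushforward_pushforward finF resF assms)
  also have "\<dots> = pushforward (obj F a) (\<lambda>x. res G a b (\<phi> a x)) v"
    by (simp only: nat)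
  also have "\<dots> = lin_res G a b (\<phi>_lin a v)"
    by (intro pushforward_pushforward[symmetric] finF finG \<phi>_maps assms)
  finally show ?thesis .
qed

text \<open>The adjoint of the square \<open>\<phi>_lin_res\<close>: both sides represent the
  functional \<open>u\<close> to \<open>ipG b (\<phi>_lin b (lin_res F a b u)) w\<close>.\<close>

lemma res_adj_\<phi>_adj:
  assumes ab: "a \<in> A" "b \<in> A" "b \<le> a" and w: "w \<in> lin (obj G b)"
  shows "res_adj F ipF a b (\<phi>_adj b w) = \<phi>_adj a (res_adj G ipG a b w)"
proof -
  interpret RF: euclidean_lin_map "obj F a" "ipF a" "obj F b" "ipF b" "res F a b"
    using ab by (rule map_resF)
  interpret RG: euclidean_lin_map "obj G a" "ipG a" "obj G b" "ipG b" "res G a b"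
    using ab by (rule map_resG)
  interpret Pa: euclidean_lin_map "obj F a" "ipF a" "obj G a" "ipG a" "\<phi> a"
    using ab by (intro map_\<phi>)
  interpret Pb: euclidean_lin_map "obj F b" "ipF b" "obj G b" "ipG b" "\<phi> b"
    using ab by (intro map_\<phi>)
  show ?thesis
    using w ab
    by (intro RF.V.adjoint_on_eqI)
      (simp_all add: Pa.adj_in_lin RG.adj_in_lin Pa.ip_adj RG.ip_adj Pb.ip_adj \<phi>_lin_res
        pushforward_in_lin[OF Pa.maps] pushforward_in_lin[OF RF.maps])
qed

text \<open>The adjoint of a direct sum is the direct sum of the adjoints. As
  \<open>messages A F\<close> is not of the form \<open>lin S\<close>, uniqueness is proved anew, by
  testing with messages supported on one arrow.\<close>

lemma phi1_adj_eq:
  assumes l: "l \<in> messages A G"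
  shows "phi1_adj A F ipF ipG \<phi> l =
    (\<lambda>(a, b). if (a, b) \<in> arrows A then \<phi>_adj b (l (a, b)) else (\<lambda>x. 0))" (is "_ = ?m")
proof -
  have l': "l (a, b) \<in> lin (obj G b)" if "(a, b) \<in> arrows A" for a b
    using l that by (auto simp: messages_def)
  have fin_arrows: "finite (arrows A)"
    by (rule finite_subset[of _ "A \<times> A"]) (auto simp: arrows_def finA)
  have m: "?m \<in> messages A F"
    using l' euclidean_lin_map.adj_in_lin[OF map_\<phi>]
    by (auto simp: messages_def) (auto simp: arrows_def)
  have adj: "message_ip A ipF u ?m = message_ip A ipG (phi1 A F \<phi> u) l"
    if u: "u \<in> messages A F" for u
  proof -
    have "ipF b (u (a, b)) (\<phi>_adj b (l (a, b))) = ipG b (\<phi>_lin b (u (a, b))) (l (a, b))"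
      if ab: "(a, b) \<in> arrows A" for a b
    proof -
      have "b \<in> A" "u (a, b) \<in> lin (obj F b)"
        using u ab by (auto simp: messages_def arrows_def)
      then show ?thesis
        using euclidean_lin_map.ip_adj[OF map_\<phi>] l'[OF ab] by blast
    qed
    then show ?thesis
      unfolding message_ip_def by (intro sum.cong refl) (auto simp: phi1_def)
  qed
  have unique: "m' = ?m"
    if m': "m' \<in> messages A F" and adj': "\<And>u. u \<in> messages A F \<Longrightarrow>
      message_ip A ipF u m' = message_ip A ipG (phi1 A F \<phi> u) l" for m'
  proof
    fix e :: "'p \<times> 'p"
    obtain a b where e: "e = (a, b)" by force
    show "m' e = ?m e"
    proof (cases "(a, b) \<in> arrows A")
      case True
      then have b: "b \<in> A" by (simp add: arrows_def)
      interpret euclidean_lin "obj F b" "ipF b"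
        using finF spF b by unfold_locales
      \<comment> \<open>Pairing with a message concentrated on \<open>(a, b)\<close> isolates that
        component and reduces uniqueness to \<open>ip_eqI\<close> there.\<close>
      have single: "message_ip A ipF ((\<lambda>_ _. 0)((a, b) := w)) k = ipF b w (k (a, b))"
        if k: "k \<in> messages A F" for w k
      proof -
        have "ipF d (\<lambda>_. 0) (k (c, d)) = 0" if cd: "(c, d) \<in> arrows A" for c d
        proof -
          have "euclidean_lin (obj F d) (ipF d)"
            using finF spF cd by unfold_locales (auto simp: arrows_def)
          moreover have "k (c, d) \<in> lin (obj F d)"
            using k cd by (auto simp: messages_def)
          ultimately show ?thesis
            by (rule euclidean_lin.ip_zero)
        qed
        then have "message_ip A ipF ((\<lambda>_ _. 0)((a, b) := w)) k =
            (\<Sum>e\<in>arrows A. if e = (a, b) then ipF b w (k (a, b)) else 0)"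
          unfolding message_ip_def by (intro sum.cong refl) (auto split: if_split_asm)
        then show ?thesis
          using True fin_arrows by simp
      qed
      have "m' (a, b) = ?m (a, b)"
      proof (rule ip_eqI)
        show "m' (a, b) \<in> lin (obj F b)" "?m (a, b) \<in> lin (obj F b)"
          using m m' True unfolding messages_def by blast+
        fix w assume "w \<in> lin (obj F b)"
        then have w: "(\<lambda>_ _. 0)((a, b) := w) \<in> messages A F"
          using True by (auto simp: messages_def)
        show "ipF b w (m' (a, b)) = ipF b w (?m (a, b))"
          using adj[OF w] adj'[OF w] unfolding single[OF m] single[OF m'] by (simp only:)
      qed
      then show ?thesis by (simp add: e)
    next
      case False
      then show ?thesis
        using m' by (simp add: e messages_def)
    qed
  qed
  show ?thesis
    \<comment> \<open>The instantiation unfolds only the adjoint on messages and keeps each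
      \<open>\<phi>_adj\<close> folded.\<close>
    unfolding phi1_adj_def adjoint_on_def[of "messages A F"]
  proof (rule the_equality, intro conjI ballI m adj, assumption, elim conjE)
    fix m' assume m': "m' \<in> messages A F"
      and adj': "\<forall>u\<in>messages A F. message_ip A ipF u m' = message_ip A ipG (phi1 A F \<phi> u) l"
    show "m' = ?m"
      by (rule unique[OF m' bspec[OF adj']])
  qed
qed

section \<open>Compatibility of the message-passing operators with the natural
  transformation\<close>

lemma d_adj_in_lin:
  assumes l: "l \<in> messages A G" and a: "a \<in> A"
  shows "d_adj A G ipG l a \<in> lin (obj G a)"
proof -
  have l': "l (c, b) \<in> lin (obj G b)" if "c \<in> A" "b \<in> A" "b \<le> c" for b c
    using l that by (auto simp: messages_def arrows_def)
  show ?thesis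
    unfolding d_adj_def if_P[OF a]
    by (intro lin_diff lin_sum) (auto intro: euclidean_lin_map.adj_in_lin[OF map_resG] l' a)
qed

text \<open>In the first sum \<open>res_adj_\<phi>_adj\<close> moves the adjoint past the
  restriction; in the second, messages into \<open>a\<close> already carry
  \<open>\<phi>_adj a\<close>. Linearity of \<open>\<phi>_adj a\<close> then collects both
  sums.\<close>

lemma d_adj_phi1_adj:
  assumes l: "l \<in> messages A G" and a: "a \<in> A"
  shows "d_adj A F ipF (phi1_adj A F ipF ipG \<phi> l) a = \<phi>_adj a (d_adj A G ipG l a)"
proof -
  have l': "l (c, b) \<in> lin (obj G b)" if "c \<in> A" "b \<in> A" "b \<le> c" for b c
    using l that by (auto simp: messages_def arrows_def)
  interpret P: euclidean_lin_map "obj F a" "ipF a" "obj G a" "ipG a" "\<phi> a"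
    using a by (rule map_\<phi>)
  have R: "res_adj G ipG a b (l (a, b)) \<in> lin (obj G a)" if "b \<in> A" "b \<le> a" for b
    by (rule euclidean_lin_map.adj_in_lin[OF map_resG[OF a that] l'[OF a that]])
  have "d_adj A F ipF (phi1_adj A F ipF ipG \<phi> l) a =
      (\<lambda>x. (\<Sum>b\<in>{b \<in> A. b \<le> a}. \<phi>_adj a (res_adj G ipG a b (l (a, b))) x) -
        (\<Sum>b\<in>{b \<in> A. a \<le> b}. \<phi>_adj a (l (b, a)) x))"
    using a l' by (auto simp: d_adj_def phi1_adj_eq[OF l] arrows_def res_adj_\<phi>_adj
        intro!: arg_cong2[where f = minus] sum.cong)
  also have "\<dots> = \<phi>_adj a (d_adj A G ipG l a)"
  proof -
    have "\<phi>_adj a (\<lambda>x. \<Sum>b\<in>{b \<in> A. b \<le> a}. res_adj G ipG a b (l (a, b)) x) =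
        (\<lambda>x. \<Sum>b\<in>{b \<in> A. b \<le> a}. \<phi>_adj a (res_adj G ipG a b (l (a, b))) x)"
      by (rule P.adj_sum) (simp add: R)
    moreover have "\<phi>_adj a (\<lambda>x. \<Sum>b\<in>{b \<in> A. a \<le> b}. l (b, a) x) =
        (\<lambda>x. \<Sum>b\<in>{b \<in> A. a \<le> b}. \<phi>_adj a (l (b, a)) x)"
      by (rule P.adj_sum) (simp add: l' a)
    ultimately show ?thesis
      unfolding d_adj_def if_P[OF a]
      by (subst P.adj_diff) (auto intro!: lin_sum simp: R l' a)
  qed
  finally show ?thesis .
qed

lemma zeta_adj_\<phi>_adj:
  assumes v: "\<And>a. a \<in> A \<Longrightarrow> v a \<in> lin (obj G a)" and v': "\<And>a. a \<in> A \<Longrightarrow> v' a = \<phi>_adj a (v a)"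
    and a: "a \<in> A"
  shows "zeta_adj A F ipF v' a = \<phi>_adj a (zeta_adj A G ipG v a)"
proof -
  interpret P: euclidean_lin_map "obj F a" "ipF a" "obj G a" "ipG a" "\<phi> a"
    using a by (rule map_\<phi>)
  have R: "res_adj G ipG a b (v b) \<in> lin (obj G a)" if "b \<in> A" "b \<le> a" for b
    by (rule euclidean_lin_map.adj_in_lin[OF map_resG[OF a that] v[OF that(1)]])
  have "zeta_adj A F ipF v' a =
      (\<lambda>x. \<Sum>b\<in>{b \<in> A. b \<le> a}. \<phi>_adj a (res_adj G ipG a b (v b)) x)"
    using a v v' by (auto simp: zeta_adj_def res_adj_\<phi>_adj intro!: sum.cong)
  also have "\<dots> = \<phi>_adj a (zeta_adj A G ipG v a)"
    unfolding zeta_adj_def if_P[OF a] by (rule P.adj_sum[symmetric]) (simp add: R)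
  finally show ?thesis .
qed

lemma zeta_adj_in_lin:
  assumes "\<And>a. a \<in> A \<Longrightarrow> v a \<in> lin (obj G a)" "a \<in> A"
  shows "zeta_adj A G ipG v a \<in> lin (obj G a)"
  unfolding zeta_adj_def if_P[OF assms(2)]
  by (intro lin_sum) (auto intro: euclidean_lin_map.adj_in_lin[OF map_resG] assms)

text \<open>The nonlinear step: \<open>\<phi>_adj\<close> inside the exponential becomes
  \<open>\<phi>_lin\<close> outside it, because the dependence on \<open>v\<close> is a common
  factor on each fibre.\<close>

lemma g_ham_pushforward_ham:
  assumes v: "v a \<in> lin (obj G a)" and v': "v' a = \<phi>_adj a (v a)" and a: "a \<in> A"
  shows "g_ham A G ipG (pushforward_ham F \<phi> H) v a =
    \<phi>_lin a (g_ham A F ipF (\<lambda>a x. ereal (H a x)) v' a)"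
proof
  fix y
  interpret P: euclidean_lin_map "obj F a" "ipF a" "obj G a" "ipG a" "\<phi> a"
    using a by (rule map_\<phi>)
  let ?X = "{x \<in> obj F a. \<phi> a x = y}" and ?c = "ipG a (v a) (indicator {y}) - 1"
  have ip: "ipF a (v' a) (indicator {x}) = ipG a (v a) (indicator {\<phi> a x})"
    if x: "x \<in> obj F a" for x
  proof -
    have y: "\<phi> a x \<in> obj G a"
      using P.maps x by blast
    have "ipF a (v' a) (indicator {x}) = ipF a (indicator {x}) (\<phi>_adj a (v a))"
      using x v v' by (simp add: P.V.ip_sym P.adj_in_lin lin_indicator)
    also have "\<dots> = ipG a (indicator {\<phi> a x}) (v a)"
      using x v by (simp add: P.ip_adj lin_indicator pushforward_indicator P.V.fin)
    finally show ?thesis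
      using y v by (simp add: P.W.ip_sym lin_indicator)
  qed
  \<comment> \<open>By \<open>ip\<close>, every \<open>x\<close> in the fibre over \<open>y\<close>
    contributes the same \<open>?c\<close>.\<close>
  have "\<phi>_lin a (g_ham A F ipF (\<lambda>a x. ereal (H a x)) v' a) y = (\<Sum>x\<in>?X. exp (- H a x) * exp ?c)"
    unfolding pushforward_def
    by (rule sum.cong)
      (auto simp: g_ham_def a ip exp_ereal_def one_ereal_def simp flip: exp_add)
  also have "\<dots> = (\<Sum>x\<in>?X. exp (- H a x)) * exp ?c"
    by (simp add: sum_distrib_right)
  also have "\<dots> = g_ham A G ipG (pushforward_ham F \<phi> H) v a y"
  proof (cases "y \<in> \<phi> a ` obj F a")
    case True
    then have "?X \<noteq> {}" "y \<in> obj G a"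
      using P.maps by blast+
    \<comment> \<open>Positivity lets \<open>exp\<close> cancel the \<open>ln\<close> in the
      pushed-forward Hamiltonian.\<close>
    then have "(\<Sum>x\<in>?X. exp (- H a x)) > 0"
      by (intro sum_pos) (auto simp: P.V.fin)
    then show ?thesis
      using True \<open>y \<in> obj G a\<close> a
      by (simp add: g_ham_def pushforward_ham_def exp_ereal_def one_ereal_def exp_add exp_diff)
  next
    case False
    \<comment> \<open>The empty sum matches \<open>exp_ereal\<close> at minus infinity if
      \<open>y\<close> lies in \<open>obj G a\<close>, and the default 0 of \<open>g_ham\<close>
      otherwise.\<close>
    then have X: "?X = {}" by blast
    show ?thesis
      unfolding X using False by (simp add: g_ham_def pushforward_ham_def exp_ereal_def one_ereal_def)
  qed
  finally show "g_ham A G ipG (pushforward_ham F \<phi> H) v a y =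
    \<phi>_lin a (g_ham A F ipF (\<lambda>a x. ereal (H a x)) v' a) y" by simp
qed

lemma delta_\<phi>_lin:
  assumes "\<And>a. a \<in> A \<Longrightarrow> w a = \<phi>_lin a (v a)"
  shows "delta A G w = phi1 A F \<phi> (delta A F v)"
  by (intro ext)
    (auto simp: delta_def phi1_def arrows_def pushforward_diff \<phi>_lin_res assms split: prod.split)

text \<open>\<open>\<phi>_adj\<close> passes through \<open>d_adj\<close> and
  \<open>zeta_adj\<close>, is turned into \<open>\<phi>_lin\<close> by \<open>g_ham\<close>, and
  leaves \<open>delta\<close> as \<open>phi1\<close>. The families are compared only at indices in
  \<open>A\<close>.\<close>

lemma delta_MP_pushforward_ham:
  assumes l: "l \<in> messages A G"
  shows "delta_MP A G ipG (pushforward_ham F \<phi> H) l =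
    phi1 A F \<phi> (delta_MP A F ipF (\<lambda>a x. ereal (H a x)) (phi1_adj A F ipF ipG \<phi> l))"
  unfolding delta_MP_def comp_apply
  by (intro delta_\<phi>_lin g_ham_pushforward_ham zeta_adj_\<phi>_adj zeta_adj_in_lin d_adj_phi1_adj
      d_adj_in_lin l)

end

theorem theorem1:
  fixes A :: "'p::order set"
    and F :: "('p, 'x) presheaf" and G :: "('p, 'y) presheaf"
    and \<phi> :: "'p \<Rightarrow> 'x \<Rightarrow> 'y"
    and H :: "'p \<Rightarrow> 'x \<Rightarrow> real"
    and ipF :: "('p, 'x) scalar_products" and ipG :: "('p, 'y) scalar_products"
  assumes "finite A"
    and "presheaf_on A F" and "presheaf_on A G"
    and "nat_trans A F G \<phi>"
    and "\<And>a. a \<in> A \<Longrightarrow> scalar_product_on (lin (obj F a)) (ipF a)"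
    and "\<And>a. a \<in> A \<Longrightarrow> scalar_product_on (lin (obj G a)) (ipG a)"
  shows "\<forall>l\<in>messages A G.
    delta_MP A G ipG (pushforward_ham F \<phi> H) l =
    (phi1 A F \<phi> \<circ> delta_MP A F ipF (\<lambda>a x. ereal (H a x)) \<circ> phi1_adj A F ipF ipG \<phi>) l"
proof -
  interpret natural_map A F G \<phi> ipF ipG
    using assms by unfold_locales
  show ?thesis
    by (simp add: delta_MP_pushforward_ham)
qed

end
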